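(* Let $G$ be a finite abelian group (written additively) of order $n$ and Davenport constant $D$. Let $\ell$ be a positive integer and put $m = n + D - \min(D,\ell) - 1$. Let $x=(x_1,\dots,x_m)\in G^m$ and let $w=(w_1,\dots,w_m)\in \mathbb{Z}^m$. Assume that $|\{i\in[1,m] : x_i = a\}|\le \ell$ for all $a\in G$. Then there are a subset $I\subset [1,m]$ and an injection $f: I\to [1,m]$ such that $n-\min(D,\ell)\le |I|\le n-1$ and $$\sum_{i\in I} w_i x_{f(i)} = 0.$$
   Context: The Davenport constant $D=D(G)$ of a finite abelian group $G$ is the maximal integer $k$ such that there is a sequence of elements of $G$ of length $k-1$ having no nonempty zero-sum subsequence (equivalently, the least $k$ such that every sequence of $k$ elements of $G$ has a nonempty subsequence with sum $0$). $[1,m]$ denotes the set of integers $\{1,\dots,m\}$ (empty if $m=0$). For $w\in\mathbb{Z}$ and $g\in G$, $wg$ denotes the usual integer multiple. The empty sum is $0$. *)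

theory Defs
  imports "HOL-Algebra.Algebra"
begin

(* Abelian groups are comm_group structures, hence written multiplicatively: zero sums are
   finprod ... = \<one> and the integer multiple w g is the power g [^] w. *)

definition zero_sum_free_seq :: "('a, 'b) monoid_scheme \<Rightarrow> nat \<Rightarrow> (nat \<Rightarrow> 'a) \<Rightarrow> bool" where
  "zero_sum_free_seq G k g \<longleftrightarrow>
     g \<in> {1..k} \<rightarrow> carrier G \<and>
     (\<forall>J \<subseteq> {1..k}. J \<noteq> {} \<longrightarrow> finprod G g J \<noteq> \<one>\<^bsub>G\<^esub>)"

(* Meaningful only if such k are bounded, which holds for finite G by zero_sum_free_seq_less_order;
   k = 0 is excluded because k - 1 truncates. *)
definition davenport_constant :: "('a, 'b) monoid_scheme \<Rightarrow> nat" where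
  "davenport_constant G = (GREATEST k. 1 \<le> k \<and> (\<exists>g. zero_sum_free_seq G (k - 1) g))"

context comm_group
begin

lemma zero_sum_free_seq_less_order:
  assumes fin: "finite (carrier G)" and zf: "zero_sum_free_seq G k g"
  shows "k < order G"
proof -
  have gc: "g \<in> {1..k} \<rightarrow> carrier G" using zf by (simp add: zero_sum_free_seq_def)
  define p where "p i = finprod G g {1..i}" for i
  have pc: "p i \<in> carrier G" if "i \<le> k" for i
    unfolding p_def by (rule finprod_closed) (use gc that in auto)
  have ne: "p i \<noteq> p j" if "i < j" "j \<le> k" for i j
  proof
    assume eq: "p i = p j"
    have c: "finprod G g {Suc i..j} \<in> carrier G"
      by (rule finprod_closed) (use gc that in auto)
    have "p j = finprod G g ({1..i} \<union> {Suc i..j})"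
      unfolding p_def by (rule arg_cong[where f = "finprod G g"]) (use that in auto)
    also have "\<dots> = p i \<otimes> finprod G g {Suc i..j}"
      unfolding p_def by (rule finprod_Un_disjoint) (use gc that in auto)
    finally have "p i \<otimes> finprod G g {Suc i..j} = p i" using eq by simp
    then have "finprod G g {Suc i..j} = \<one>"
      using c pc[of i] that by simp
    moreover have "{Suc i..j} \<subseteq> {1..k}" "{Suc i..j} \<noteq> {}" using that by auto
    ultimately show False using zf by (auto simp: zero_sum_free_seq_def)
  qed
  have "inj_on p {..k}"
  proof (rule inj_onI)
    fix i j assume "i \<in> {..k}" "j \<in> {..k}" "p i = p j"
    then show "i = j" using ne[of i j] ne[of j i] by (cases i j rule: linorder_cases) simp_all
  qed
  then have "card {..k} \<le> card (carrier G)"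
    by (rule card_inj_on_le) (use pc fin in auto)
  then show ?thesis by (simp add: order_def)
qed

lemma zero_sum_free_seq_mono:
  assumes "zero_sum_free_seq G k g" "j \<le> k"
  shows "zero_sum_free_seq G j g"
proof -
  have sub: "{1..j} \<subseteq> {1..k}" using assms(2) by auto
  note zf = assms(1)[unfolded zero_sum_free_seq_def]
  have "g \<in> {1..j} \<rightarrow> carrier G"
    by (rule subsetD[OF Pi_anti_mono[OF sub] conjunct1[OF zf]])
  moreover have "\<forall>J \<subseteq> {1..j}. J \<noteq> {} \<longrightarrow> finprod G g J \<noteq> \<one>"
    using conjunct2[OF zf] sub by (meson order_trans)
  ultimately show ?thesis unfolding zero_sum_free_seq_def by (rule conjI)
qed

lemma zero_sum_free_seq_bound:
  assumes fin: "finite (carrier G)" and "1 \<le> k \<and> (\<exists>g. zero_sum_free_seq G (k - 1) g)"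
  shows "k \<le> order G"
proof -
  obtain g where "zero_sum_free_seq G (k - 1) g" using assms(2) by blast
  from zero_sum_free_seq_less_order[OF fin this] show ?thesis by linarith
qed

lemma davenport_constant_attained:
  assumes fin: "finite (carrier G)"
  shows "1 \<le> davenport_constant G \<and> (\<exists>g. zero_sum_free_seq G (davenport_constant G - 1) g)"
  unfolding davenport_constant_def
proof (rule GreatestI_nat)
  show "1 \<le> (1::nat) \<and> (\<exists>g. zero_sum_free_seq G (1 - 1) g)"
    by (simp add: zero_sum_free_seq_def)
qed (rule zero_sum_free_seq_bound[OF fin])

lemma davenport_constant_upper:
  assumes fin: "finite (carrier G)" and zf: "zero_sum_free_seq G k g"
  shows "k < davenport_constant G"
proof -
  have "1 \<le> Suc k \<and> (\<exists>g. zero_sum_free_seq G (Suc k - 1) g)"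
    by (rule conjI, simp, rule exI[of _ g], simp only: diff_Suc_1 zf)
  then have "Suc k \<le> davenport_constant G"
    unfolding davenport_constant_def
    by (rule Greatest_le_nat) (rule zero_sum_free_seq_bound[OF fin])
  then show ?thesis by simp
qed

lemma davenport_constant_le_order:
  assumes fin: "finite (carrier G)"
  shows "davenport_constant G \<le> order G"
  by (rule zero_sum_free_seq_bound[OF fin davenport_constant_attained[OF fin]])

lemma davenport_constant_eq_Least:
  assumes fin: "finite (carrier G)"
  shows "davenport_constant G =
    (LEAST k. \<forall>g \<in> {1..k} \<rightarrow> carrier G. \<exists>J \<subseteq> {1..k}. J \<noteq> {} \<and> finprod G g J = \<one>)"
proof (rule Least_equality[symmetric])
  show "\<forall>g \<in> {1..davenport_constant G} \<rightarrow> carrier G.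
      \<exists>J \<subseteq> {1..davenport_constant G}. J \<noteq> {} \<and> finprod G g J = \<one>"
  proof (rule ballI, rule ccontr)
    fix g assume "g \<in> {1..davenport_constant G} \<rightarrow> carrier G"
      and "\<not> (\<exists>J \<subseteq> {1..davenport_constant G}. J \<noteq> {} \<and> finprod G g J = \<one>)"
    then have "zero_sum_free_seq G (davenport_constant G) g"
      unfolding zero_sum_free_seq_def by meson
    from davenport_constant_upper[OF fin this] show False by linarith
  qed
  fix k :: nat
  assume k: "\<forall>g \<in> {1..k} \<rightarrow> carrier G. \<exists>J \<subseteq> {1..k}. J \<noteq> {} \<and> finprod G g J = \<one>"
  obtain g where g: "zero_sum_free_seq G (davenport_constant G - 1) g"
    using davenport_constant_attained[OF fin] by (elim conjE exE)
  show "davenport_constant G \<le> k"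
  proof (rule ccontr)
    assume "\<not> davenport_constant G \<le> k"
    then have "k \<le> davenport_constant G - 1" by linarith
    from zero_sum_free_seq_mono[OF g this] have "zero_sum_free_seq G k g" .
    then show False using k unfolding zero_sum_free_seq_def by meson
  qed
qed

end

end

(* Key step: n weights and n terms, each term value occurring at most l times, contain a matching
   of size between 1 and l with zero sum. Let h be the largest number of weights in one residue
   class r modulo n and k the largest multiplicity of a term, attained at a. If k \<le> h, use only
   weights congruent to r and apply to the terms the endomorphism of multiplication by r; if h < k,
   use only copies of a and apply to the residues of the weights the homomorphism Z/n \<rightarrow> G, v \<mapsto> v a.
   In both cases one has n elements of a group of order n, each with multiplicity at most min h k,
   and wants a short subsequence whose image has zero sum. Fibres of the homomorphism enlarge the
   multiplicities by exactly the factor by which the image is smaller than n, so the images split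
   into min h k sets of distinct elements of total size at least the order of the image, and the
   Kemperman-Scherk bound |A + B| \<ge> |A| + |B| - 1 (for 0 having only the trivial representation)
   yields the zero sum.

   Removing such short matchings while at least n indices remain, then a zero-sum subsequence of
   the rest that omits fewer than D indices, and putting the short matchings back one at a time
   makes the size land in the prescribed window of length l. *)

theory Submission
  imports Defs
begin

lemma finite_has_greatest_nat:
  fixes g :: "'c \<Rightarrow> nat"
  assumes "finite R" "R \<noteq> {}"
  shows "\<exists>r\<in>R. \<forall>s\<in>R. g s \<le> g r"
proof -
  have "Max (g ` R) \<in> g ` R" using assms by (intro Max_in) auto
  then obtain r where "r \<in> R" "Max (g ` R) = g r" by auto
  then show ?thesis using assms(1) by (metis Max_ge finite_imageI imageI)
qed

section \<open>Sumset bound and short one-products from coloured indices\<close>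

context comm_group
begin

text \<open>Proved by a transform of Dyson type: with a suitable \<open>a\<close> in
  \<open>A\<close>, the elements \<open>c\<close> of \<open>B\<close> for which
  \<open>a \<otimes> c\<close> lies outside \<open>A\<close> are deleted from \<open>B\<close>, and
  the products \<open>a \<otimes> c\<close> are added to \<open>A\<close>. The sum of the
  cardinalities is preserved, the product set does not grow, the hypothesis on representations of
  \<open>\<one>\<close> survives, and \<open>B\<close> shrinks until only \<open>\<one>\<close> is
  left.\<close>

lemma card_set_mult_unique_one:
  assumes "finite A" "finite B" "A \<subseteq> carrier G" "B \<subseteq> carrier G" "\<one> \<in> A" "\<one> \<in> B"
    and "\<And>a b. \<lbrakk>a \<in> A; b \<in> B; a \<otimes> b = \<one>\<rbrakk> \<Longrightarrow> b = \<one>"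
  shows "card A + card B \<le> Suc (card (A <#> B))"
  using assms
proof (induction "card B" arbitrary: A B rule: less_induct)
  case less
  note sub = subsetD[OF less.prems(3)] subsetD[OF less.prems(4)]
  have finAB: "finite (A <#> B)"
    using less.prems(1,2) by (simp add: set_mult_def)
  show ?case
  proof (cases "B = {\<one>}")
    case True
    have "A <#> B = A"
      using True less.prems(3) by (force simp: set_mult_def)
    then show ?thesis using True by simp
  next
    case False
    then obtain b where b: "b \<in> B" "b \<noteq> \<one>" using less.prems(6) by blast
    \<comment> \<open>Otherwise translation by \<open>b\<close> permutes the finite set
      \<open>A\<close> and hence hits \<open>\<one>\<close>, which represents \<open>\<one>\<close>
      with the nontrivial factor \<open>b\<close>.\<close>
    have "\<exists>a\<in>A. a \<otimes> b \<notin> A"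
    proof (rule ccontr)
      assume "\<not> ?thesis"
      then have "(\<lambda>a. a \<otimes> b) ` A \<subseteq> A" by blast
      moreover have "inj_on (\<lambda>a. a \<otimes> b) A"
        using sub b(1) by (auto intro!: inj_onI)
      ultimately have "(\<lambda>a. a \<otimes> b) ` A = A"
        by (rule endo_inj_surj[OF less.prems(1)])
      then obtain a where "a \<in> A" "a \<otimes> b = \<one>" using less.prems(5) by (metis imageE)
      then show False using less.prems(7) b by blast
    qed
    then obtain a where a: "a \<in> A" "a \<otimes> b \<notin> A" by blast
    define C where "C = {c \<in> B. a \<otimes> c \<notin> A}"
    define A' where "A' = A \<union> (\<lambda>c. a \<otimes> c) ` C"
    define B' where "B' = B - C"
    have C: "C \<subseteq> B" "b \<in> C" "\<one> \<notin> C" "finite C"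
      using a b less.prems(2) sub by (auto simp: C_def)
    have cA': "card A' = card A + card C"
    proof -
      have "inj_on (\<lambda>c. a \<otimes> c) C"
        using a(1) C(1) sub by (meson inj_onI l_cancel subsetD)
      then have "card ((\<lambda>c. a \<otimes> c) ` C) = card C" by (rule card_image)
      moreover have "A \<inter> (\<lambda>c. a \<otimes> c) ` C = {}" by (auto simp: C_def)
      ultimately show ?thesis
        unfolding A'_def using less.prems(1) C(4) by (simp add: card_Un_disjoint)
    qed
    have cB': "card B' + card C = card B"
      unfolding B'_def using C less.prems(2) by (simp add: card_Diff_subset card_mono)
    have "card C > 0" using C by (auto simp: card_gt_0_iff)
    have incl: "A' <#> B' \<subseteq> A <#> B"
    proof
      fix u assume "u \<in> A' <#> B'"
      then obtain x y where xy: "x \<in> A'" "y \<in> B'" "u = x \<otimes> y" by (auto simp: set_mult_def)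
      show "u \<in> A <#> B"
      proof (cases "x \<in> A")
        case True
        then show ?thesis using xy by (auto simp: set_mult_def B'_def)
      next
        case False
        then obtain c where c: "c \<in> C" "x = a \<otimes> c" using xy by (auto simp: A'_def)
        \<comment> \<open>Since \<open>y\<close> was not deleted, \<open>a\<close> can be moved from
          \<open>c\<close> to \<open>y\<close>: the product
          \<open>(a \<otimes> c) \<otimes> y\<close> is also
          \<open>(a \<otimes> y) \<otimes> c\<close>, now with first factor in \<open>A\<close>. The
          same exchange is used below for representations of \<open>\<one>\<close>.\<close>
        have "a \<otimes> y \<in> A" "y \<in> B" using xy by (auto simp: B'_def C_def)
        moreover have "u = (a \<otimes> y) \<otimes> c"
          using xy(3) c a(1) C(1) sub \<open>y \<in> B\<close> by (auto simp: m_ac)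
        ultimately show ?thesis using c C(1) by (auto simp: set_mult_def)
      qed
    qed
    have "card A' + card B' \<le> Suc (card (A' <#> B'))"
    proof (rule less.hyps)
      show "card B' < card B" using cB' \<open>card C > 0\<close> by simp
      fix x y assume xy: "x \<in> A'" "y \<in> B'" "x \<otimes> y = \<one>"
      show "y = \<one>"
      proof (cases "x \<in> A")
        case True
        then show ?thesis using xy less.prems(7) by (auto simp: B'_def)
      next
        case False
        then obtain c where c: "c \<in> C" "x = a \<otimes> c" using xy by (auto simp: A'_def)
        have ay: "a \<otimes> y \<in> A" "y \<in> B" using xy by (auto simp: B'_def C_def)
        have "(a \<otimes> y) \<otimes> c = \<one>"
          using xy(3) c a(1) C(1) sub ay(2) by (auto simp: m_ac)
        then have "c = \<one>" using less.prems(7) ay(1) c(1) C(1) by blast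
        then show ?thesis using c C(3) by simp
      qed
    qed (use less.prems a C sub in \<open>auto simp: A'_def B'_def\<close>)
    also have "card (A' <#> B') \<le> card (A <#> B)" by (rule card_mono[OF finAB incl])
    finally show ?thesis using cA' cB' by simp
  qed
qed

lemma subgroup_finprod_closed:
  assumes H: "subgroup H G" and "y \<in> J \<rightarrow> H"
  shows "finprod G y J \<in> H"
  using assms(2)
proof (induction J rule: infinite_finite_induct)
  case (insert i J)
  have "H \<subseteq> carrier G" by (rule subgroup.subset[OF H])
  then have "finprod G y (insert i J) = y i \<otimes> finprod G y J"
    using insert by (intro finprod_insert) auto
  then show ?case using insert subgroup.m_closed[OF H] by auto
qed (auto intro: subgroup.one_closed[OF H])

text \<open>If no one-product with at most \<open>k\<close> factors existed, the products over index
  sets with at most one index of each colour would gain, from every colour class, at least its size.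
  After \<open>k\<close> colours there would be more than \<open>card H\<close> of them, all in
  \<open>H\<close>.\<close>

lemma one_product_transversal:
  fixes c :: "'i \<Rightarrow> nat"
  assumes H: "subgroup H G" "finite H" and I: "finite I" "y \<in> I \<rightarrow> H" "card H \<le> card I"
    and col: "c \<in> I \<rightarrow> {..<k}" "\<And>j. j < k \<Longrightarrow> inj_on y {i \<in> I. c i = j}"
  shows "\<exists>J \<subseteq> I. J \<noteq> {} \<and> card J \<le> k \<and> finprod G y J = \<one>"
proof (rule ccontr)
  assume neg: "\<not> ?thesis"
  have HG: "H \<subseteq> carrier G" by (rule subgroup.subset[OF H(1)])
  have yG: "y \<in> J \<rightarrow> carrier G" if "J \<subseteq> I" for J using I(2) HG that by auto
  \<comment> \<open>Partial transversals of the first \<open>j\<close> colours; one index per colour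
    is what bounds their size by \<open>j\<close>.\<close>
  define P where "P j = {J. J \<subseteq> {i \<in> I. c i < j} \<and> inj_on c J}" for j
  define T where "T j = finprod G y ` P j" for j
  have T_sub: "T j \<subseteq> H" for j
    using I(2) by (auto simp: T_def P_def intro!: subgroup_finprod_closed[OF H(1)])
  have T_one: "\<one> \<in> T j" for j
    unfolding T_def by (rule image_eqI[of _ _ "{}"]) (auto simp: P_def)
  have small: "card J \<le> j" if "J \<in> P j" for J j
  proof -
    have "card J = card (c ` J)" using that by (simp add: P_def card_image)
    also have "\<dots> \<le> card {..<j}" using that by (intro card_mono) (auto simp: P_def)
    finally show ?thesis by simp
  qed
  \<comment> \<open>The extra 1 counts the empty product; it yields the strict inequality needed for
    the final contradiction.\<close>
  have "Suc (card {i \<in> I. c i < j}) \<le> card (T j)" if "j \<le> k" for j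
    using that
  proof (induction j)
    case 0
    have "T 0 = {\<one>}" by (auto simp: T_def P_def)
    then show ?case by simp
  next
    case (Suc j)
    define L where "L = {i \<in> I. c i = j}"
    \<comment> \<open>The added \<open>\<one>\<close> stands for choosing no index of colour
      \<open>j\<close>. It is a new element, because a single index with value \<open>\<one>\<close>
      would already be a short one-product.\<close>
    define B where "B = insert \<one> (y ` L)"
    have extend: "insert i J \<in> P (Suc j)" "finprod G y (insert i J) = finprod G y J \<otimes> y i"
      if "J \<in> P j" "i \<in> L" for i J
    proof -
      have JI: "J \<subseteq> I" "i \<in> I" "i \<notin> J" "finite J"
        using that I(1) by (auto simp: P_def L_def intro: finite_subset)
      show "insert i J \<in> P (Suc j)" using that by (fastforce simp: P_def L_def inj_on_def)
      have "finprod G y (insert i J) = y i \<otimes> finprod G y J"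
        using JI yG[of J] yG[of "{i}"] by (intro finprod_insert) auto
      then show "finprod G y (insert i J) = finprod G y J \<otimes> y i"
        using JI yG[of J] yG[of "{i}"] by (simp add: m_comm)
    qed
    have nontriv: "finprod G y (insert i J) \<noteq> \<one>" if "J \<in> P j" "i \<in> L" for i J
    proof -
      have "card (insert i J) \<le> k" using small[OF extend(1)[OF that]] Suc.prems by simp
      then show ?thesis using neg extend(1)[OF that] by (auto simp: P_def)
    qed
    have BG: "B \<subseteq> carrier G" using yG[of I] by (auto simp: B_def L_def)
    have "card B = Suc (card L)"
    proof -
      have "\<one> \<notin> y ` L"
      proof
        assume "\<one> \<in> y ` L"
        then obtain i where "i \<in> L" "y i = \<one>" by force
        then show False using nontriv[of "{}" i] by (auto simp: P_def)
      qed
      moreover have "card (y ` L) = card L"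
        using col(2)[of j] Suc.prems by (simp add: L_def card_image)
      moreover have "finite L" using I(1) by (simp add: L_def)
      ultimately show ?thesis by (simp add: B_def)
    qed
    \<comment> \<open>A representation of \<open>\<one>\<close> with nontrivial second factor would
      be a one-product over at most \<open>Suc j\<close> indices, and \<open>Suc j\<close> does not
      exceed \<open>k\<close>.\<close>
    moreover have "card (T j) + card B \<le> Suc (card (T j <#> B))"
    proof (rule card_set_mult_unique_one)
      fix t b assume tb: "t \<in> T j" "b \<in> B" "t \<otimes> b = \<one>"
      show "b = \<one>"
      proof (rule ccontr)
        assume "b \<noteq> \<one>"
        then obtain i where i: "i \<in> L" "b = y i" using tb(2) by (auto simp: B_def)
        obtain J where J: "J \<in> P j" "t = finprod G y J" using tb(1) by (auto simp: T_def)
        show False using nontriv[OF J(1) i(1)] extend(2)[OF J(1) i(1)] J(2) i(2) tb(3) by simp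
      qed
    qed (use T_sub[of j] HG H(2) T_one BG I(1) in \<open>auto simp: B_def L_def intro: finite_subset\<close>)
    moreover have "card (T j <#> B) \<le> card (T (Suc j))"
    proof (rule card_mono)
      show "finite (T (Suc j))" using T_sub H(2) by (rule finite_subset)
      show "T j <#> B \<subseteq> T (Suc j)"
      proof
        fix u assume "u \<in> T j <#> B"
        then obtain J b where u: "J \<in> P j" "b \<in> B" "u = finprod G y J \<otimes> b"
          by (auto simp: set_mult_def T_def)
        have "J \<in> P (Suc j)" using u(1) by (auto simp: P_def)
        have "finprod G y J \<in> carrier G" using T_sub[of j] HG u(1) by (auto simp: T_def)
        show "u \<in> T (Suc j)"
        proof (cases "b = \<one>")
          case True
          then show ?thesis using u(3) \<open>J \<in> P (Suc j)\<close> \<open>finprod G y J \<in> carrier G\<close>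
            by (simp add: T_def)
        next
          case False
          then obtain i where "i \<in> L" "b = y i" using u(2) by (auto simp: B_def)
          then show ?thesis using extend[OF u(1)] u(3) by (metis T_def image_eqI)
        qed
      qed
    qed
    moreover have "card {i \<in> I. c i < Suc j} = card {i \<in> I. c i < j} + card L"
    proof -
      have "{i \<in> I. c i < Suc j} = {i \<in> I. c i < j} \<union> L" by (auto simp: L_def)
      then show ?thesis using I(1) by (simp add: card_Un_disjoint L_def disjoint_iff)
    qed
    ultimately show ?case using Suc by simp
  qed
  from this[of k] have "Suc (card I) \<le> card (T k)"
    using col(1) by (simp add: Collect_conj_eq Int_absorb2 subset_iff Pi_iff)
  also have "\<dots> \<le> card H" by (rule card_mono[OF H(2) T_sub])
  finally show False using I(3) by simp
qed


section \<open>Short one-products in homomorphic images\<close>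

lemma card_hom_fiber:
  assumes U: "group U" "\<phi> \<in> hom U G" and u0: "u0 \<in> carrier U"
  shows "card {u \<in> carrier U. \<phi> u = \<phi> u0} = card (kernel U G \<phi>)"
proof -
  interpret U: group U by (rule U(1))
  interpret \<phi>: group_hom U G \<phi> by unfold_locales (rule U(2))
  have "bij_betw (\<lambda>u. u0 \<otimes>\<^bsub>U\<^esub> u) (kernel U G \<phi>) {u \<in> carrier U. \<phi> u = \<phi> u0}"
  proof (rule bij_betw_byWitness[where f' = "\<lambda>u. inv\<^bsub>U\<^esub> u0 \<otimes>\<^bsub>U\<^esub> u"])
    show "\<forall>u\<in>kernel U G \<phi>. inv\<^bsub>U\<^esub> u0 \<otimes>\<^bsub>U\<^esub> (u0 \<otimes>\<^bsub>U\<^esub> u) = u"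
      using u0 by (simp add: kernel_def flip: U.m_assoc)
    show "\<forall>u\<in>{u \<in> carrier U. \<phi> u = \<phi> u0}. u0 \<otimes>\<^bsub>U\<^esub> (inv\<^bsub>U\<^esub> u0 \<otimes>\<^bsub>U\<^esub> u) = u"
      using u0 by (simp flip: U.m_assoc)
  qed (use u0 in \<open>auto simp: kernel_def\<close>)
  then show ?thesis by (metis bij_betw_same_card)
qed

text \<open>Common form of both cases of the key step. With \<open>t\<close> the size of the kernel,
  each image value occurs at most \<open>t * k\<close> times, so keeping at most \<open>k\<close>
  indices per value loses at most a factor \<open>t\<close>. As \<open>order U = t * card H\<close>,
  at least \<open>card H\<close> indices are kept.\<close>

lemma short_one_product_hom:
  fixes z :: "'i \<Rightarrow> 'u"
  assumes U: "group U" "finite (carrier U)" "\<phi> \<in> hom U G"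
    and I: "finite I" "z \<in> I \<rightarrow> carrier U" "order U \<le> card I"
    and mult: "\<And>u. u \<in> carrier U \<Longrightarrow> card {i \<in> I. z i = u} \<le> k"
  shows "\<exists>J \<subseteq> I. J \<noteq> {} \<and> card J \<le> k \<and> (\<Otimes>i\<in>J. \<phi> (z i)) = \<one>"
proof -
  interpret U: group U by (rule U(1))
  interpret \<phi>: group_hom U G \<phi> by unfold_locales (rule U(3))
  define H where "H = \<phi> ` carrier U"
  define t where "t = card (kernel U G \<phi>)"
  define y where "y = (\<lambda>i. \<phi> (z i))"
  define F where "F c = {i \<in> I. y i = c}" for c
  have H: "subgroup H G" "finite H" using \<phi>.img_is_subgroup U(2) by (auto simp: H_def)
  have yH: "y \<in> I \<rightarrow> H" using I(2) by (auto simp: y_def H_def)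
  have finF: "finite (F c)" for c using I(1) by (simp add: F_def)
  have "\<one>\<^bsub>U\<^esub> \<in> kernel U G \<phi>" "finite (kernel U G \<phi>)" using U(2) by (auto simp: kernel_def)
  then have "t > 0" by (auto simp: t_def card_gt_0_iff)
  have fiber: "card {u \<in> carrier U. \<phi> u = c} = t" if "c \<in> H" for c
    using that card_hom_fiber[OF U(1,3)] by (auto simp: H_def t_def)
  have order_U: "order U = t * card H"
  proof -
    have "order U = (\<Sum>c\<in>H. card {u \<in> carrier U. \<phi> u = c})"
      unfolding order_def H_def card_eq_sum by (rule sum.image_gen[OF U(2)])
    then show ?thesis using fiber by simp
  qed
  have card_F: "card (F c) \<le> t * k" if "c \<in> H" for c
  proof -
    have "F c \<subseteq> (\<Union>u\<in>{u \<in> carrier U. \<phi> u = c}. {i \<in> I. z i = u})"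
      using I(2) by (auto simp: F_def y_def)
    then have "card (F c) \<le> card (\<Union>u\<in>{u \<in> carrier U. \<phi> u = c}. {i \<in> I. z i = u})"
      by (intro card_mono) (use U(2) I(1) in auto)
    also have "\<dots> \<le> (\<Sum>u\<in>{u \<in> carrier U. \<phi> u = c}. card {i \<in> I. z i = u})"
      by (rule card_UN_le) (use U(2) in auto)
    also have "\<dots> \<le> (\<Sum>u\<in>{u \<in> carrier U. \<phi> u = c}. k)"
      by (rule sum_mono) (use mult in auto)
    also have "\<dots> = t * k" using fiber[OF that] by simp
    finally show ?thesis .
  qed
  \<comment> \<open>Numbering each fibre from 0 provides the colouring: ranks below \<open>k\<close>
    are kept, and two kept indices with the same rank and the same value coincide.\<close>
  have "\<forall>c. \<exists>r. bij_betw r (F c) {0..<card (F c)}"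
    using ex_bij_betw_finite_nat[OF finF] by blast
  then obtain rank where rank: "\<And>c. bij_betw (rank c) (F c) {0..<card (F c)}" by metis
  define I' where "I' = {i \<in> I. rank (y i) i < k}"
  have card_F': "card (F c \<inter> I') = min k (card (F c))" for c
  proof -
    have "F c \<inter> I' = {i \<in> F c. rank c i < k}" by (auto simp: F_def I'_def)
    moreover have "bij_betw (rank c) {i \<in> F c. rank c i < k} {0..<min k (card (F c))}"
    proof (rule bij_betw_imageI)
      show "inj_on (rank c) {i \<in> F c. rank c i < k}"
        using rank[of c] by (auto simp: bij_betw_def inj_on_def)
      have "rank c ` {i \<in> F c. rank c i < k} = rank c ` F c \<inter> {..<k}" by auto
      also have "\<dots> = {0..<min k (card (F c))}"
        unfolding bij_betw_imp_surj_on[OF rank[of c]] by auto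
      finally show "rank c ` {i \<in> F c. rank c i < k} = {0..<min k (card (F c))}" .
    qed
    ultimately show ?thesis using bij_betw_same_card by fastforce
  qed
  have count: "card L = (\<Sum>c\<in>H. card {i \<in> L. y i = c})" if "L \<subseteq> I" for L
    unfolding card_eq_sum
    by (rule sum.group[symmetric]) (use that I(1) H(2) yH in \<open>auto intro: finite_subset\<close>)
  have "card I = (\<Sum>c\<in>H. card (F c))"
    unfolding F_def by (rule count) simp
  also have "\<dots> \<le> (\<Sum>c\<in>H. t * card (F c \<inter> I'))"
  proof (rule sum_mono)
    fix c assume "c \<in> H"
    then show "card (F c) \<le> t * card (F c \<inter> I')"
      using card_F \<open>t > 0\<close> by (simp add: card_F' min_def)
  qed
  also have "\<dots> = t * card I'"
  proof -
    have "F c \<inter> I' = {i \<in> I'. y i = c}" for c by (auto simp: F_def I'_def)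
    then have "(\<Sum>c\<in>H. card (F c \<inter> I')) = card I'"
      using count[of I'] by (simp add: I'_def)
    then show ?thesis by (simp flip: sum_distrib_left)
  qed
  finally have "t * card H \<le> t * card I'" using I(3) order_U by linarith
  then have "card H \<le> card I'" using \<open>t > 0\<close> by simp
  have "\<exists>J \<subseteq> I'. J \<noteq> {} \<and> card J \<le> k \<and> finprod G y J = \<one>"
  proof (rule one_product_transversal[OF H, where c = "\<lambda>i. rank (y i) i"])
    fix j
    show "inj_on y {i \<in> I'. rank (y i) i = j}"
    proof (rule inj_onI)
      fix a b assume ab: "a \<in> {i \<in> I'. rank (y i) i = j}" "b \<in> {i \<in> I'. rank (y i) i = j}" "y a = y b"
      then have "a \<in> F (y a)" "b \<in> F (y a)" "rank (y a) a = rank (y a) b"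
        by (auto simp: F_def I'_def)
      then show "a = b" using rank[of "y a"] by (auto simp: bij_betw_def inj_on_def)
    qed
  qed (use I(1) yH \<open>card H \<le> card I'\<close> in \<open>auto simp: I'_def\<close>)
  then show ?thesis unfolding y_def I'_def by blast
qed

section \<open>Short matchings between weights and terms\<close>

lemma int_pow_mod_order:
  fixes v :: int
  assumes "finite (carrier G)" "a \<in> carrier G"
  shows "a [^] (v mod int (order G)) = a [^] v"
proof -
  have "a [^] v = a [^] (int (order G) * (v div int (order G)) + v mod int (order G))" by simp
  also have "\<dots> = (a [^] int (order G)) [^] (v div int (order G)) \<otimes> a [^] (v mod int (order G))"
    using assms by (simp only: int_pow_mult int_pow_pow)
  also have "a [^] int (order G) = \<one>"
    using assms by (simp add: int_pow_int pow_order_eq_1)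
  finally show ?thesis using assms by simp
qed

lemma short_one_product_matching:
  fixes x :: "'j \<Rightarrow> 'a" and w :: "'i \<Rightarrow> int"
  assumes fin: "finite (carrier G)"
    and S: "finite S" "order G \<le> card S"
    and T: "finite T" "order G \<le> card T" "x \<in> T \<rightarrow> carrier G"
    and mult: "\<And>a. a \<in> carrier G \<Longrightarrow> card {j \<in> T. x j = a} \<le> l"
  shows "\<exists>J f. J \<subseteq> S \<and> J \<noteq> {} \<and> card J \<le> l \<and> f ` J \<subseteq> T \<and> inj_on f J \<and>
           (\<Otimes>i\<in>J. x (f i) [^] w i) = \<one>"
proof -
  define n where "n = order G"
  have n: "0 < n" using fin by (simp add: n_def order_gt_0_iff_finite)
  define C where "C r = {i \<in> S. w i mod int n = r}" for r
  define F where "F a = {j \<in> T. x j = a}" for a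
  obtain r where r: "r \<in> {0..<int n}" "\<And>s. s \<in> {0..<int n} \<Longrightarrow> card (C s) \<le> card (C r)"
    using finite_has_greatest_nat[of "{0..<int n}" "\<lambda>s. card (C s)"] n by auto
  obtain a where a: "a \<in> carrier G" "\<And>b. b \<in> carrier G \<Longrightarrow> card (F b) \<le> card (F a)"
    using finite_has_greatest_nat[OF fin, of "\<lambda>b. card (F b)"] by auto
  have Fl: "card (F a) \<le> l" using mult[OF a(1)] by (simp add: F_def)
  have fins: "finite (C r)" "finite (F a)" using S(1) T(1) by (simp_all add: C_def F_def)
  show ?thesis
  proof (cases "card (F a) \<le> card (C r)")
    case True
    \<comment> \<open>The terms are selected first. There are at most \<open>card (F a)\<close> of
      them, so \<open>C r\<close> holds enough weights, and any bijection will do because these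
      weights all act as \<open>r\<close>.\<close>
    have "\<exists>J \<subseteq> T. J \<noteq> {} \<and> card J \<le> card (F a) \<and> (\<Otimes>j\<in>J. x j [^] r) = \<one>"
    proof (rule short_one_product_hom[where U = G and \<phi> = "\<lambda>u. u [^] r"])
      show "(\<lambda>u. u [^] r) \<in> hom G G" by (auto simp: hom_def int_pow_distrib)
      show "card {j \<in> T. x j = u} \<le> card (F a)" if "u \<in> carrier G" for u
        using a(2)[OF that] by (simp add: F_def)
    qed (use fin T in auto)
    then obtain J' where J': "J' \<subseteq> T" "J' \<noteq> {}" "card J' \<le> card (F a)"
      "(\<Otimes>j\<in>J'. x j [^] r) = \<one>" by blast
    have "finite J'" using J'(1) T(1) by (rule finite_subset)
    obtain J where J: "J \<subseteq> C r" "card J = card J'" "finite J"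
      using obtain_subset_with_card_n[of "card J'" "C r"] J'(3) True by force
    obtain f where f: "bij_betw f J J'"
      using finite_same_card_bij[OF J(3) \<open>finite J'\<close> J(2)] by blast
    have img: "f ` J = J'" "inj_on f J" using f by (auto simp: bij_betw_def)
    have xG: "x (f i) \<in> carrier G" if "i \<in> J" for i
      using that img(1) J'(1) T(3) by blast
    have "(\<Otimes>i\<in>J. x (f i) [^] w i) = (\<Otimes>i\<in>J. x (f i) [^] r)"
    proof (rule finprod_cong')
      fix i assume "i \<in> J"
      then have "w i mod int (order G) = r" using J(1) by (auto simp: C_def n_def)
      then show "x (f i) [^] w i = x (f i) [^] r"
        using int_pow_mod_order[OF fin xG[OF \<open>i \<in> J\<close>], of "w i"] by simp
    qed (use xG in auto)
    also have "\<dots> = (\<Otimes>j\<in>f ` J. x j [^] r)"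
      by (rule finprod_reindex[symmetric]) (use xG img in auto)
    also have "\<dots> = \<one>" using img(1) J'(4) by simp
    finally have "(\<Otimes>i\<in>J. x (f i) [^] w i) = \<one>" .
    moreover have "J \<noteq> {}" using J'(2) img(1) by blast
    moreover have "J \<subseteq> S" using J(1) by (auto simp: C_def)
    ultimately show ?thesis using J(2) J'(1,3) Fl img by (intro exI[of _ J] exI[of _ f]) auto
  next
    case False
    \<comment> \<open>Here the weights are selected first. Fewer than \<open>card (F a)\<close> of
      them are used, so they can be sent injectively to copies of \<open>a\<close>.\<close>
    have "\<exists>J \<subseteq> S. J \<noteq> {} \<and> card J \<le> card (C r) \<and> (\<Otimes>i\<in>J. a [^] (w i mod int n)) = \<one>"
    proof (rule short_one_product_hom[where U = "integer_mod_group n"])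
      show "([^]) a \<in> hom (integer_mod_group n) G"
        using a(1) by (auto simp: hom_def n_def int_pow_mod_order[OF fin] int_pow_mult)
      show "card {i \<in> S. w i mod int n = u} \<le> card (C r)" if "u \<in> carrier (integer_mod_group n)" for u
        using r(2)[of u] that n by (simp add: C_def carrier_integer_mod_group)
      show "order (integer_mod_group n) \<le> card S"
        using S(2) n by (simp add: order_def carrier_integer_mod_group n_def)
    qed (use S n in \<open>auto simp: carrier_integer_mod_group\<close>)
    then obtain J where J: "J \<subseteq> S" "J \<noteq> {}" "card J \<le> card (C r)"
      "(\<Otimes>i\<in>J. a [^] (w i mod int n)) = \<one>" by blast
    have "finite J" using J(1) S(1) by (rule finite_subset)
    obtain f where f: "f ` J \<subseteq> F a" "inj_on f J"
      using card_le_inj[OF \<open>finite J\<close> fins(2)] J(3) False by fastforce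
    have xa: "x (f i) = a" if "i \<in> J" for i using f(1) that by (auto simp: F_def)
    have "(\<Otimes>i\<in>J. x (f i) [^] w i) = (\<Otimes>i\<in>J. a [^] (w i mod int n))"
      by (rule finprod_cong') (use xa a(1) in \<open>auto simp: n_def int_pow_mod_order[OF fin]\<close>)
    then have "(\<Otimes>i\<in>J. x (f i) [^] w i) = \<one>" using J(4) by simp
    then show ?thesis
      using J False Fl f by (intro exI[of _ J] exI[of _ f]) (auto simp: F_def)
  qed
qed

section \<open>One-products that omit few indices, and control of their size\<close>

text \<open>The complement of a largest one-product subset has no nonempty one-product subset, since
  its union with the largest one would be larger. Hence the complement has fewer than
  \<open>davenport_constant G\<close> elements.\<close>

lemma large_one_product_subset:
  assumes fin: "finite (carrier G)" and S: "finite S" "y \<in> S \<rightarrow> carrier G"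
  shows "\<exists>I \<subseteq> S. finprod G y I = \<one> \<and> card S < card I + davenport_constant G"
proof -
  define \<I> where "\<I> = {I. I \<subseteq> S \<and> finprod G y I = \<one>}"
  have "finite \<I>" "\<I> \<noteq> {}" using S(1) by (auto simp: \<I>_def)
  then obtain I where I: "I \<in> \<I>" "\<And>I'. I' \<in> \<I> \<Longrightarrow> card I' \<le> card I"
    using finite_has_greatest_nat[of \<I> card] by blast
  have IS: "I \<subseteq> S" "finprod G y I = \<one>" "finite I"
    using I(1) S(1) by (auto simp: \<I>_def intro: finite_subset)
  define k where "k = card (S - I)"
  obtain h where h: "bij_betw h {1..k} (S - I)"
    using finite_same_card_bij[of "{1..k}" "S - I"] S(1) by (auto simp: k_def)
  have yG: "y \<in> L \<rightarrow> carrier G" if "L \<subseteq> S" for L using S(2) that by auto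
  have "zero_sum_free_seq G k (y \<circ> h)"
    unfolding zero_sum_free_seq_def
  proof (intro conjI allI impI)
    show "y \<circ> h \<in> {1..k} \<rightarrow> carrier G"
      using bij_betwE[OF h] S(2) by auto
    fix J assume J: "J \<subseteq> {1..k}" "J \<noteq> {}"
    have hJ: "h ` J \<subseteq> S - I" "inj_on h J"
      using J(1) h by (auto simp: bij_betw_def intro: inj_on_subset)
    show "finprod G (y \<circ> h) J \<noteq> \<one>"
    proof
      assume "finprod G (y \<circ> h) J = \<one>"
      then have "finprod G y (h ` J) = \<one>"
        using finprod_reindex[of y h J] hJ yG[of "h ` J"] by (auto simp: comp_def)
      moreover have "finite (h ` J)" "I \<inter> h ` J = {}" "h ` J \<subseteq> S"
        using hJ S(1) by (auto intro: finite_subset)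
      ultimately have "finprod G y (I \<union> h ` J) = \<one>"
        using finprod_Un_disjoint[of I "h ` J" y] IS yG by simp
      then have "card (I \<union> h ` J) \<le> card I"
        using I(2) IS \<open>h ` J \<subseteq> S\<close> by (simp add: \<I>_def)
      moreover have "card (I \<union> h ` J) = card I + card (h ` J)"
        using IS(3) \<open>finite (h ` J)\<close> \<open>I \<inter> h ` J = {}\<close> by (rule card_Un_disjoint)
      ultimately show False using J(2) \<open>finite (h ` J)\<close> by simp
    qed
  qed
  then have "k < davenport_constant G" by (rule davenport_constant_upper[OF fin])
  then show ?thesis
    using IS card_Diff_subset[OF IS(3,1)] card_mono[OF S(1) IS(1)] by (auto simp: k_def)
qed

text \<open>The pairing is arbitrary: any bijection from \<open>S\<close> to \<open>T\<close> is
  fixed, and indices are then discarded.\<close>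

lemma large_one_product_matching:
  fixes x :: "'j \<Rightarrow> 'a" and w :: "'i \<Rightarrow> int"
  assumes fin: "finite (carrier G)"
    and S: "finite S" and T: "finite T" "x \<in> T \<rightarrow> carrier G" "card T = card S"
  shows "\<exists>I f. I \<subseteq> S \<and> f ` I \<subseteq> T \<and> inj_on f I \<and> card S < card I + davenport_constant G \<and>
           (\<Otimes>i\<in>I. x (f i) [^] w i) = \<one>"
proof -
  obtain f where f: "bij_betw f S T"
    using finite_same_card_bij[OF S T(1)] T(3) by auto
  obtain I where "I \<subseteq> S" "(\<Otimes>i\<in>I. x (f i) [^] w i) = \<one>" "card S < card I + davenport_constant G"
    using large_one_product_subset[OF fin S, of "\<lambda>i. x (f i) [^] w i"] f T(2)
    by (auto simp: bij_betw_def)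
  then show ?thesis
    using f by (intro exI[of _ I] exI[of _ f]) (auto simp: bij_betw_def intro: inj_on_subset)
qed

text \<open>Induction on \<open>card S\<close>, splitting off a short matching while at least
  \<open>order G\<close> indices remain. The disjunction serves as invariant: either the size has
  reached the window of length \<open>l\<close>, or fewer than \<open>davenport_constant G\<close>
  indices are uncovered.\<close>

lemma medium_one_product_matching:
  fixes x :: "'j \<Rightarrow> 'a" and w :: "'i \<Rightarrow> int"
  assumes fin: "finite (carrier G)" and l: "l < order G"
    and "finite S" "finite T" "x \<in> T \<rightarrow> carrier G" "card T = card S"
    and "\<And>a. a \<in> carrier G \<Longrightarrow> card {j \<in> T. x j = a} \<le> l"
  shows "\<exists>I f. I \<subseteq> S \<and> f ` I \<subseteq> T \<and> inj_on f I \<and> card I < order G \<and>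
           (order G \<le> card I + l \<or> card S < card I + davenport_constant G) \<and>
           (\<Otimes>i\<in>I. x (f i) [^] w i) = \<one>"
  using assms(3-)
proof (induction "card S" arbitrary: S T rule: less_induct)
  case less
  show ?case
  proof (cases "card S < order G")
    case True
    obtain I f where I: "I \<subseteq> S" "f ` I \<subseteq> T" "inj_on f I"
      "card S < card I + davenport_constant G" "(\<Otimes>i\<in>I. x (f i) [^] w i) = \<one>"
      using large_one_product_matching[OF fin less.prems(1-4), of w] by blast
    moreover have "card I < order G"
      using card_mono[OF less.prems(1) I(1)] True by simp
    ultimately show ?thesis by blast
  next
    case False
    obtain J g where J: "J \<subseteq> S" "J \<noteq> {}" "card J \<le> l" "g ` J \<subseteq> T" "inj_on g J"
      "(\<Otimes>i\<in>J. x (g i) [^] w i) = \<one>"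
      using short_one_product_matching[of S T x l w] fin False less.prems by auto
    have finJ: "finite J" using J(1) less.prems(1) by (rule finite_subset)
    have cardS: "card (S - J) + card J = card S" and cardT: "card (T - g ` J) + card J = card T"
      using card_Diff_subset[of J S] card_mono[OF less.prems(1) J(1)] finJ J(1)
        card_Diff_subset[of "g ` J" T] card_mono[OF less.prems(2) J(4)] J(4)
        card_image[OF J(5)] by simp_all
    have "card J > 0" using J(2) finJ by (simp add: card_gt_0_iff)
    have "\<exists>I f. I \<subseteq> S - J \<and> f ` I \<subseteq> T - g ` J \<and> inj_on f I \<and> card I < order G \<and>
           (order G \<le> card I + l \<or> card (S - J) < card I + davenport_constant G) \<and>
           (\<Otimes>i\<in>I. x (f i) [^] w i) = \<one>"
    proof (rule less.hyps)
      fix a assume "a \<in> carrier G"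
      have "card {j \<in> T - g ` J. x j = a} \<le> card {j \<in> T. x j = a}"
        by (rule card_mono) (use less.prems(2) in auto)
      then show "card {j \<in> T - g ` J. x j = a} \<le> l"
        using less.prems(5)[OF \<open>a \<in> carrier G\<close>] by simp
    qed (use less.prems cardS cardT \<open>card J > 0\<close> in auto)
    then obtain I f where I: "I \<subseteq> S - J" "f ` I \<subseteq> T - g ` J" "inj_on f I" "card I < order G"
      "order G \<le> card I + l \<or> card (S - J) < card I + davenport_constant G"
      "(\<Otimes>i\<in>I. x (f i) [^] w i) = \<one>" by blast
    show ?thesis
    proof (cases "order G \<le> card I + l")
      case True
      then show ?thesis using I by (intro exI[of _ I] exI[of _ f]) auto
    next
      case False
      \<comment> \<open>Below the window, the short matching is put back. As \<open>card J\<close>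
        is at most \<open>l\<close>, the size stays below \<open>order G\<close>; as all of
        \<open>J\<close> becomes covered, the number of uncovered indices is unchanged.\<close>
      define f' where "f' i = (if i \<in> J then g i else f i)" for i
      have disj: "I \<inter> J = {}" and finI: "finite I"
        using I(1) less.prems(1) by (auto intro: finite_subset)
      have f'I: "f' i = f i" if "i \<in> I" for i using that disj by (auto simp: f'_def)
      have f'J: "f' i = g i" if "i \<in> J" for i using that by (simp add: f'_def)
      have "inj_on f' (I \<union> J)"
        using I(2,3) J(5) disj by (auto simp: inj_on_def f'_def)
      moreover have "f' ` (I \<union> J) \<subseteq> T" using I(2) J(4) by (auto simp: f'_def)
      moreover have "(\<Otimes>i\<in>I \<union> J. x (f' i) [^] w i) = \<one>"
      proof -
        have G: "(\<lambda>i. x (f' i) [^] w i) \<in> I \<union> J \<rightarrow> carrier G"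
          using \<open>f' ` (I \<union> J) \<subseteq> T\<close> less.prems(3) by blast
        have "(\<Otimes>i\<in>I \<union> J. x (f' i) [^] w i) =
            (\<Otimes>i\<in>I. x (f' i) [^] w i) \<otimes> (\<Otimes>i\<in>J. x (f' i) [^] w i)"
          by (rule finprod_Un_disjoint) (use finI finJ disj G in auto)
        also have "(\<Otimes>i\<in>I. x (f' i) [^] w i) = (\<Otimes>i\<in>I. x (f i) [^] w i)"
          by (rule finprod_cong') (use I(2) less.prems(3) f'I in auto)
        also have "(\<Otimes>i\<in>J. x (f' i) [^] w i) = (\<Otimes>i\<in>J. x (g i) [^] w i)"
          by (rule finprod_cong') (use J(4) less.prems(3) f'J in auto)
        finally show ?thesis using I(6) J(6) by simp
      qed
      moreover have "card (I \<union> J) = card I + card J"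
        using finI finJ disj by (rule card_Un_disjoint)
      ultimately show ?thesis
        using I(1,5) J(1,3) False cardS by (intro exI[of _ "I \<union> J"] exI[of _ f']) auto
    qed
  qed
qed

end

section \<open>Comparison of \<open>l\<close> with the Davenport constant\<close>

theorem theorem1:
  fixes G :: "('a, 'b) monoid_scheme" (structure)
    and n D l m :: nat
    and x :: "nat \<Rightarrow> 'a"
    and w :: "nat \<Rightarrow> int"
  assumes "comm_group G"
    and "finite (carrier G)"
    and "n = order G"
    and "D = davenport_constant G"
    and "0 < l"
    and "m = n + D - min D l - 1"
    and "x \<in> {1..m} \<rightarrow> carrier G"
    and "\<forall>a \<in> carrier G. card {i \<in> {1..m}. x i = a} \<le> l"
  shows "\<exists>I f. I \<subseteq> {1..m} \<and> f ` I \<subseteq> {1..m} \<and> inj_on f I \<and>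
           n - min D l \<le> card I \<and> card I \<le> n - 1 \<and>
           (\<Otimes>i\<in>I. x (f i) [^] w i) = \<one>"
proof -
  interpret comm_group G by fact
  have Dn: "D \<le> n" using davenport_constant_le_order assms(2-4) by simp
  have npos: "0 < n" using assms(2,3) by (simp add: order_gt_0_iff_finite)
  show ?thesis
  proof (cases "l < D")
    case True
    have "l < order G" using True Dn assms(3) by simp
    from medium_one_product_matching[OF assms(2) this, of "{1..m}" "{1..m}" x w] assms(7,8)
    obtain I f where I: "I \<subseteq> {1..m}" "f ` I \<subseteq> {1..m}" "inj_on f I" "card I < n"
      "n \<le> card I + l \<or> m < card I + D" "(\<Otimes>i\<in>I. x (f i) [^] w i) = \<one>"
      using assms(3,4) by auto
    \<comment> \<open>Both alternatives give the lower bound: here \<open>m = n + D - l - 1\<close>,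
      so \<open>m < card I + D\<close> also means that \<open>card I\<close> is at least
      \<open>n - l\<close>.\<close>
    then show ?thesis
      using True assms(6) by (intro exI[of _ I] exI[of _ f]) auto
  next
    case False
    \<comment> \<open>With only \<open>n - 1\<close> indices the upper bound is automatic, and
      omitting fewer than \<open>D\<close> of them gives the lower bound
      \<open>n - D\<close>.\<close>
    then have m: "m = n - 1" using assms(6) by simp
    obtain I f where I: "I \<subseteq> {1..m}" "f ` I \<subseteq> {1..m}" "inj_on f I" "m < card I + D"
      "(\<Otimes>i\<in>I. x (f i) [^] w i) = \<one>"
      using large_one_product_matching[OF assms(2), of "{1..m}" "{1..m}" x w] assms(4,7) by auto
    then show ?thesis
      using False m npos card_mono[OF _ I(1)] by (intro exI[of _ I] exI[of _ f]) auto
  qed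
qed

end
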